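(* Let $n=1$, $\mathcal F=[0,+\infty)$ and, for each integer $k>0$, let $x_k=\frac1{k+1}$, let $p_k=\frac1{k+1}+\frac1{(k+1)^2}$, let $g_k$ be a random variable equal to $1$ with probability $p_k$ and to $0$ with probability $1-p_k$, and let $G_k=\mathbb E[g_k]=p_k$ (so that $g_k$ is an unbiased oracle for $G_k$). Let $P_{\mathcal F}(y)=\max\{0,y\}$, $\Xi_k=P_{\mathcal F}(x_k-G_k)-x_k$ and $d_k=P_{\mathcal F}(x_k-g_k)-x_k$. Then $|G_{k+1}-G_k|\le 3\,|x_{k+1}-x_k|$ for all $k>0$, and $$\lim_{k\to\infty}\frac{\mathbb E[|d_k|]}{\mathbb E[|\Xi_k|]}=0.$$ Consequently there is no constant $\kappa_{\rm opt}>0$ such that $\mathbb E[|\Xi_k|]\le\kappa_{\rm opt}\,\mathbb E[|d_k|]$ for all $k>0$: in the presence of bounds, the rate of decrease of $\mathbb E[|d_k|]$ does not in general translate to a similar rate of decrease for $\mathbb E[|\Xi_k|]$, even for unbiased gradient oracles.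
   Context: For the problem of minimizing a smooth $f$ over $\mathcal F$, with $x_k\in\mathcal F$ an iterate, $G_k$ plays the role of the true gradient at $x_k$ and $g_k$ that of a random approximation of it; $|\Xi_k|$ is the true projected-gradient criticality measure and $|d_k|$ its approximate counterpart computed with $g_k$. *)

theory Defs
  imports "HOL-Probability.Probability"
begin

definition feasible :: "real set" where
  "feasible = {0..}"

definition proj :: "real \<Rightarrow> real" where
  "proj y = max 0 y"

lemma proj_eq_closest_point: "proj y = closest_point feasible y"
proof (rule closest_point_unique)
  show "convex feasible" "closed feasible"
    by (simp_all add: feasible_def)
  show "proj y \<in> feasible"
    by (simp add: feasible_def proj_def)
  show "\<forall>z\<in>feasible. dist y (proj y) \<le> dist y z"
    by (auto simp: feasible_def proj_def dist_real_def)
qed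

definition iter :: "nat \<Rightarrow> real" where
  "iter k = 1 / (real k + 1)"

lemma iter_feasible: "iter k \<in> feasible"
  by (simp add: iter_def feasible_def)

definition prob_one :: "nat \<Rightarrow> real" where
  "prob_one k = 1 / (real k + 1) + 1 / (real k + 1)^2"

text \<open>Only the indices \<open>k > 0\<close> are constrained: \<open>prob_one 0 = 2\<close> is not a probability.
  No joint distribution (such as independence) is imposed on the oracle values.\<close>

definition gradient_oracle :: "'a measure \<Rightarrow> (nat \<Rightarrow> 'a \<Rightarrow> real) \<Rightarrow> bool" where
  "gradient_oracle M g \<longleftrightarrow> prob_space M \<and>
     (\<forall>k>0. g k \<in> borel_measurable M \<and>
        measure M {\<omega> \<in> space M. g k \<omega> = 1} = prob_one k \<and>
        measure M {\<omega> \<in> space M. g k \<omega> = 0} = 1 - prob_one k)"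

definition true_grad :: "'a measure \<Rightarrow> (nat \<Rightarrow> 'a \<Rightarrow> real) \<Rightarrow> nat \<Rightarrow> real" where
  "true_grad M g k = prob_space.expectation M (g k)"

definition true_step :: "'a measure \<Rightarrow> (nat \<Rightarrow> 'a \<Rightarrow> real) \<Rightarrow> nat \<Rightarrow> real" where
  "true_step M g k = proj (iter k - true_grad M g k) - iter k"

definition approx_step :: "(nat \<Rightarrow> 'a \<Rightarrow> real) \<Rightarrow> nat \<Rightarrow> 'a \<Rightarrow> real" where
  "approx_step g k \<omega> = proj (iter k - g k \<omega>) - iter k"

text \<open>Such oracles exist, for instance on the unit interval with Lebesgue measure.\<close>

lemma gradient_oracle_exists:
  "\<exists>(M :: real measure) g. gradient_oracle M g"
proof -
  let ?M = "uniform_measure lborel {0..1::real}"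
  let ?g = "\<lambda>k. indicator {0..prob_one k} :: real \<Rightarrow> real"
  have ps: "prob_space ?M"
    by (rule prob_space_uniform_measure) auto
  have "measure ?M {\<omega> \<in> space ?M. ?g k \<omega> = 1} = prob_one k \<and>
        measure ?M {\<omega> \<in> space ?M. ?g k \<omega> = 0} = 1 - prob_one k" if "k > 0" for k
  proof -
    interpret prob_space ?M by (rule ps)
    define t where "t = 1 / (real k + 1)"
    have t: "0 \<le> t" "t \<le> 1/2"
      using that by (auto simp: t_def field_simps)
    have "t^2 \<le> (1/2)^2"
      using t by (intro power_mono) auto
    then have t2: "t^2 \<le> 1/4"
      by (simp add: power2_eq_square)
    have "prob_one k = t + t^2"
      by (simp add: prob_one_def t_def power_divide)
    then have p: "0 \<le> prob_one k" "prob_one k \<le> 1"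
      using t t2 by simp_all
    have s1: "{\<omega> \<in> space ?M. ?g k \<omega> = 1} = {0..prob_one k}"
      by (auto simp: indicator_def)
    have s0: "{\<omega> \<in> space ?M. ?g k \<omega> = 0} = space ?M - {0..prob_one k}"
      by (auto simp: indicator_def)
    have i: "{0..1} \<inter> {0..prob_one k} = {0..prob_one k}"
      using p by auto
    have "emeasure ?M {0..prob_one k} = ennreal (prob_one k)"
      using p by (subst emeasure_uniform_measure) (auto simp: i divide_ennreal[of _ 1, simplified])
    then have m: "measure ?M {0..prob_one k} = prob_one k"
      using p by (simp add: measure_def)
    show ?thesis
      unfolding s1 s0 using m prob_compl[of "{0..prob_one k}"] by simp
  qed
  then have "gradient_oracle ?M ?g"
    using ps by (auto simp: gradient_oracle_def)
  then show ?thesis by blast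
qed

end

theory Submission
  imports Defs
begin

text \<open>The projection onto the half-line makes the map from gradients to steps nonlinear, and
  that is what breaks the comparison. The true gradient exceeds the current iterate, so the exact
  projected step always runs into the bound and has length \<open>iter k\<close>. The random gradient is
  usually \<open>0\<close>, giving no step at all; when it is \<open>1\<close>, however far it points beyond the bound, the
  projection cuts the step down to the same length \<open>iter k\<close>. Averaging therefore gives
  \<open>prob_one k * iter k\<close> for the random step (\<open>expectation_abs_approx_step\<close>) against \<open>iter k\<close> for the
  exact one (\<open>abs_true_step\<close>), and the ratio of the two is the probability \<open>prob_one k\<close>, which
  tends to \<open>0\<close>.\<close>

text \<open>The two prescribed probabilities add up to \<open>1\<close>, so \<open>g k\<close> takes no other value up to a
  null set, and any function of it has a two-term expectation.\<close>

lemma gradient_oracle_expectation: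
  fixes h :: "real \<Rightarrow> real"
  assumes go: "gradient_oracle M g" and "k > 0" and h [measurable]: "h \<in> borel_measurable borel"
  shows "prob_space.expectation M (\<lambda>\<omega>. h (g k \<omega>)) = h 1 * prob_one k + h 0 * (1 - prob_one k)"
proof -
  interpret prob_space M
    using go by (simp add: gradient_oracle_def)
  have g [measurable]: "g k \<in> borel_measurable M"
    using go \<open>k > 0\<close> by (simp add: gradient_oracle_def)
  define A where "A = {\<omega> \<in> space M. g k \<omega> = 1}"
  define B where "B = {\<omega> \<in> space M. g k \<omega> = 0}"
  have [measurable]: "A \<in> sets M" "B \<in> sets M"
    unfolding A_def B_def by measurable
  have pA: "prob A = prob_one k" and pB: "prob B = 1 - prob_one k"
    using go \<open>k > 0\<close> by (simp_all add: gradient_oracle_def A_def B_def)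
  have disj: "A \<inter> B = {}"
    by (auto simp: A_def B_def)
  have "prob (A \<union> B) = 1"
    by (subst finite_measure_Union) (simp_all add: disj pA pB)
  then have "AE \<omega> in M. \<omega> \<in> A \<union> B"
    by (rule AE_prob_1)
  then have "AE \<omega> in M. h (g k \<omega>) = h 1 * indicator A \<omega> + h 0 * indicator B \<omega>"
    by eventually_elim (auto simp: A_def B_def)
  then have "expectation (\<lambda>\<omega>. h (g k \<omega>))
      = expectation (\<lambda>\<omega>. h 1 * indicator A \<omega> + h 0 * indicator B \<omega>)"
    by (intro integral_cong_AE) simp_all
  also have "\<dots> = h 1 * prob A + h 0 * prob B"
    by (subst Bochner_Integration.integral_add) (simp_all add: emeasure_eq_measure)
  finally show ?thesis
    by (simp add: pA pB)
qed

lemma iter_pos: "iter k > 0"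
  by (simp add: iter_def)

lemma iter_le_one: "iter k \<le> 1"
  by (simp add: iter_def)

lemma prob_one_iter: "prob_one k = iter k + (iter k)^2"
  by (simp add: prob_one_def iter_def power_divide)

lemma prob_one_tendsto_0: "prob_one \<longlonglongrightarrow> 0"
proof -
  have "iter \<longlonglongrightarrow> 0"
    using LIMSEQ_inverse_real_of_nat unfolding iter_def by (simp add: inverse_eq_divide add.commute)
  from tendsto_add[OF this tendsto_power[OF this, of 2]] show ?thesis
    by (simp add: prob_one_iter[abs_def])
qed

text \<open>As a function of the iterate the gradient is \<open>x + x\<^sup>2\<close>, whose difference quotients are at
  most \<open>3\<close> on the unit interval.\<close>

lemma prob_one_lipschitz: "\<bar>prob_one j - prob_one k\<bar> \<le> 3 * \<bar>iter j - iter k\<bar>"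
proof -
  have "prob_one j - prob_one k = (1 + iter j + iter k) * (iter j - iter k)"
    by (simp add: prob_one_iter power2_eq_square algebra_simps)
  then have "\<bar>prob_one j - prob_one k\<bar> = (1 + iter j + iter k) * \<bar>iter j - iter k\<bar>"
    using iter_pos[of j] iter_pos[of k] by (simp add: abs_mult)
  also have "\<dots> \<le> 3 * \<bar>iter j - iter k\<bar>"
    using iter_le_one[of j] iter_le_one[of k] by (intro mult_right_mono) simp_all
  finally show ?thesis .
qed

lemma true_grad_eq:
  assumes "gradient_oracle M g" and "k > 0"
  shows "true_grad M g k = prob_one k"
  using gradient_oracle_expectation[OF assms, of "\<lambda>y. y"] by (simp add: true_grad_def)

text \<open>The second-order term of \<open>prob_one\<close> places the true gradient above the iterate, so the
  exact step is clipped at the origin.\<close>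

lemma abs_true_step:
  assumes "gradient_oracle M g" and "k > 0"
  shows "\<bar>true_step M g k\<bar> = iter k"
  using iter_pos[of k] by (simp add: true_step_def proj_def true_grad_eq[OF assms] prob_one_iter)

lemma expectation_abs_approx_step:
  assumes "gradient_oracle M g" and "k > 0"
  shows "prob_space.expectation M (\<lambda>\<omega>. \<bar>approx_step g k \<omega>\<bar>) = prob_one k * iter k"
proof -
  have "(\<lambda>y. \<bar>proj (iter k - y) - iter k\<bar>) \<in> borel_measurable borel"
    unfolding proj_def by measurable
  from gradient_oracle_expectation[OF assms this] show ?thesis
    using iter_pos[of k] iter_le_one[of k] by (simp add: approx_step_def proj_def)
qed

theorem mainTheorem5:
  fixes M :: "'a measure" and g :: "nat \<Rightarrow> 'a \<Rightarrow> real"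
  assumes "gradient_oracle M g"
  shows "(\<forall>k>0. true_grad M g k = prob_one k) \<and>
    (\<forall>k>0. \<bar>true_grad M g (k + 1) - true_grad M g k\<bar> \<le> 3 * \<bar>iter (k + 1) - iter k\<bar>) \<and>
    (\<lambda>k. prob_space.expectation M (\<lambda>\<omega>. \<bar>approx_step g k \<omega>\<bar>)
          / prob_space.expectation M (\<lambda>_. \<bar>true_step M g k\<bar>)) \<longlonglongrightarrow> 0 \<and>
    \<not> (\<exists>\<kappa>>0. \<forall>k>0. prob_space.expectation M (\<lambda>_. \<bar>true_step M g k\<bar>)
          \<le> \<kappa> * prob_space.expectation M (\<lambda>\<omega>. \<bar>approx_step g k \<omega>\<bar>))"
proof (intro conjI)
  interpret prob_space M
    using assms by (simp add: gradient_oracle_def)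
  note grad = true_grad_eq[OF assms]
  note approx = expectation_abs_approx_step[OF assms]
  have exact: "expectation (\<lambda>_. \<bar>true_step M g k\<bar>) = iter k" if "k > 0" for k
    using abs_true_step[OF assms that] by (simp add: prob_space)
  show "\<forall>k>0. true_grad M g k = prob_one k"
    by (simp add: grad)
  show "\<forall>k>0. \<bar>true_grad M g (k + 1) - true_grad M g k\<bar> \<le> 3 * \<bar>iter (k + 1) - iter k\<bar>"
    using prob_one_lipschitz by (simp add: grad)
  have "expectation (\<lambda>\<omega>. \<bar>approx_step g k \<omega>\<bar>) / expectation (\<lambda>_. \<bar>true_step M g k\<bar>) = prob_one k"
    if "k > 0" for k
    unfolding approx[OF that] exact[OF that] using iter_pos[of k] by simp
  then have "\<forall>\<^sub>F k in sequentially. prob_one k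
      = expectation (\<lambda>\<omega>. \<bar>approx_step g k \<omega>\<bar>) / expectation (\<lambda>_. \<bar>true_step M g k\<bar>)"
    by (intro eventually_mono[OF eventually_gt_at_top[of 0]]) (rule sym)
  then show "(\<lambda>k. expectation (\<lambda>\<omega>. \<bar>approx_step g k \<omega>\<bar>)
      / expectation (\<lambda>_. \<bar>true_step M g k\<bar>)) \<longlonglongrightarrow> 0"
    by (rule Lim_transform_eventually[OF prob_one_tendsto_0])
  show "\<not> (\<exists>\<kappa>>0. \<forall>k>0. expectation (\<lambda>_. \<bar>true_step M g k\<bar>)
      \<le> \<kappa> * expectation (\<lambda>\<omega>. \<bar>approx_step g k \<omega>\<bar>))"
  proof
    assume "\<exists>\<kappa>>0. \<forall>k>0. expectation (\<lambda>_. \<bar>true_step M g k\<bar>)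
      \<le> \<kappa> * expectation (\<lambda>\<omega>. \<bar>approx_step g k \<omega>\<bar>)"
    then obtain \<kappa> where bound: "\<And>k. k > 0 \<Longrightarrow> expectation (\<lambda>_. \<bar>true_step M g k\<bar>)
      \<le> \<kappa> * expectation (\<lambda>\<omega>. \<bar>approx_step g k \<omega>\<bar>)"
      by blast
    have "1 \<le> \<kappa> * prob_one k" if "k > 0" for k
    proof -
      have "1 * iter k \<le> (\<kappa> * prob_one k) * iter k"
        using bound[OF that] unfolding approx[OF that] exact[OF that] by (simp add: mult.assoc)
      then show ?thesis
        using iter_pos[of k] by (simp only: mult_le_cancel_right_pos)
    qed
    then have "\<forall>\<^sub>F k in sequentially. 1 \<le> \<kappa> * prob_one k"
      by (rule eventually_mono[OF eventually_gt_at_top[of 0]])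
    with tendsto_mult_right_zero[OF prob_one_tendsto_0, of \<kappa>] have "1 \<le> (0::real)"
      by (rule tendsto_lowerbound) simp
    then show False by simp
  qed
qed

end
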